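(* Let $N=(N_i)_{i\ge0}$ be a nonnegative column-reduced real matrix sequence in fixed-size Frobenius form with diagonal blocks $A_1,\dots,A_{\hat l}$. Then: (i) For each $2\le k\le\hat l$, $\widehat\pi_k$ defines a surjective map from $\mathcal V_{\widehat N_k}^{\mathbf 0}$ to $\mathcal V_{\widehat N_{k-1}}^{\mathbf 0}$. (ii) $\mathcal V_N^{\mathbf 0}=\iota(\mathcal V_{A_1\,\mathrm{dist}}^{\mathbf 0})+\dots+\iota(\mathcal V_{A_{\hat l}\,\mathrm{dist}}^{\mathbf 0})$; and in fact, defining $\mathcal I(\mathbf w_1,\dots,\mathbf w_{\hat l})=\iota\mathbf w_1+\dots+\iota\mathbf w_{\hat l}$, the map $$\mathcal I:\prod_{k=1}^{\hat l}\mathcal V_{A_k\,\mathrm{dist}}^{\mathbf 0}\to\mathcal V_N^{\mathbf 0}$$ is a bijection. (iii) The map $$\iota:\bigcup_{k=1}^{\hat l}\mathrm{Ext}_{\mathrm{dist}}\,\mathcal V_{A_k}\to\mathrm{Ext}\,\mathcal V_N$$ is a bijection.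
   Context: **Fixed-size Frobenius form (for all times $i\ge0$).** The matrices $N_i$ are $(l\times l)$, nonnegative real, with $l=\tilde l_1+\dots+\tilde l_{\hat l}$, and have the block upper triangular form $$N=\begin{bmatrix}A_1&C_{12}&\cdots&C_{1\hat l}\\ 0&A_2&&\vdots\\ \vdots&&\ddots&\\ 0&\cdots&&A_{\hat l}\end{bmatrix}$$ with $(A_j)_i$ of size $(\tilde l_j\times\tilde l_j)$, where for each $j$ the sequence $A_j=((A_j)_i)_{i\ge0}$ is either column-reduced and primitive or identically zero (zero for all $i$). The block columns with, for all $i$, a nonzero block only in the diagonal position occur first; the block rows with, for all $i$, a nonzero block only in the diagonal position occur last (a block of both kinds being arbitrarily assigned to one of the two). Moreover, among the blocks $(C_{jk})_i$ of $N_i$ with $j<k$, those which are zero occur in the same positions $(j,k)$ for all $i$. Column-reduced means: no all-zero columns. A sequence $N$ is primitive if for every $k$ there is $n>k$ with $N_kN_{k+1}\cdots N_n$ strictly positive. **Vector sequences.** $V$ is the space of sequences $\mathbf v=(\mathbf v_i)_{i\ge0}$, $\mathbf v_i\in\mathbb R^l$, with the product topology; a matrix sequence acts by $(N\mathbf v)_i=N_i\mathbf v_{i+1}$, and $N^m$ is the $m$-th iterate, $(N^m\mathbf v)_i=N_iN_{i+1}\cdots N_{i+m-1}\mathbf v_{i+m}$. $V=V_1\times\cdots\times V_{\hat l}$, where $V_k$ is the space of sequences in $\mathbb R^{\tilde l_k}$ (the coordinates of block $k$); $\mathtt e$ denotes each natural embedding $V_k\hookrightarrow V$ (filling in zeros).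 For a nonnegative matrix sequence $K$, $\mathcal V_K^{\mathbf 0}$ is the convex cone of vector sequences $\mathbf w$ with $\mathbf w_i\ge0$ and $\mathbf w_i=K_i\mathbf w_{i+1}$ for all $i$. An extreme vector of a convex cone is a nonzero element of an extreme ray; $\mathrm{Ext}\,\mathcal V_K$ is the set of extreme vectors of $\mathcal V_K^{\mathbf 0}$. $\mathcal V_{A_k\,\mathrm{dist}}^{\mathbf 0}$ is the convex cone of those $\mathbf w\in\mathcal V_{A_k}^{\mathbf 0}$ for which $$\iota\mathbf w=\iota(\mathbf w)=\lim_{n\to\infty}N^n\mathtt e(\mathbf w)$$ exists; $\mathrm{Ext}_{\mathrm{dist}}\mathcal V_{A_k}$ is the set of extreme vectors of $\mathcal V_{A_k\,\mathrm{dist}}^{\mathbf 0}$. In (iii) the sets for different $k$ are regarded as disjoint. For $1\le k\le\hat l$, $\widehat N_k$ is the $(l\times l)$ matrix sequence obtained from $N$ by keeping the blocks in block rows and columns $1,\dots,k$ and replacing all other blocks by zero. For $2\le k\le\hat l$ and $\mathbf v\in\mathcal V_{\widehat N_k}^{\mathbf 0}$, $$\widehat\pi_k\mathbf v=\lim_{n\to\infty}(\widehat N_{k-1})^n\mathbf v$$ (if the limit exists). *)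

theory Defs
  imports Complex_Main "HOL-Library.FuncSet" "Jordan_Normal_Form.Matrix"
begin

section \<open>Matrix sequences and vector sequences\<close>

type_synonym mseq = "nat \<Rightarrow> real mat"
type_synonym vseq = "nat \<Rightarrow> real vec"

definition column_reduced :: "mseq \<Rightarrow> bool" where
  "column_reduced M \<longleftrightarrow> (\<forall>i. \<forall>b < dim_col (M i). col (M i) b \<noteq> 0\<^sub>v (dim_row (M i)))"

text \<open>\<open>mseq_prod d M k n\<close> is the product \<open>M\<^sub>k M\<^sub>k\<^sub>+\<^sub>1 \<dots> M\<^sub>n\<close> of \<open>d \<times> d\<close> matrices.\<close>

definition mseq_prod :: "nat \<Rightarrow> mseq \<Rightarrow> nat \<Rightarrow> nat \<Rightarrow> real mat" where
  "mseq_prod d M k n = foldr (*) (map M [k..<Suc n]) (1\<^sub>m d)"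

definition primitive_mseq :: "nat \<Rightarrow> mseq \<Rightarrow> bool" where
  "primitive_mseq d M \<longleftrightarrow>
     (\<forall>k. \<exists>n>k. \<forall>a<d. \<forall>b<d. mseq_prod d M k n $$ (a, b) > 0)"

definition act :: "mseq \<Rightarrow> vseq \<Rightarrow> vseq" where
  "act M v = (\<lambda>i. M i *\<^sub>v v (Suc i))"

text \<open>
  Convergence of sequences of vector sequences for the product topology on
  the \<open>\<nat>\<close>-fold product of copies of \<open>\<real>\<^sup>d\<close>, that is, convergence of every coordinate
  at every time.
\<close>

definition vseq_tendsto :: "nat \<Rightarrow> (nat \<Rightarrow> vseq) \<Rightarrow> vseq \<Rightarrow> bool" where
  "vseq_tendsto d X w \<longleftrightarrow>
     (\<forall>i. w i \<in> carrier_vec d \<and> (\<forall>a<d. (\<lambda>n. X n i $ a) \<longlonglongrightarrow> w i $ a))"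

definition vseq_convergent :: "nat \<Rightarrow> (nat \<Rightarrow> vseq) \<Rightarrow> bool" where
  "vseq_convergent d X \<longleftrightarrow> (\<exists>w. vseq_tendsto d X w)"

definition vseq_lim :: "nat \<Rightarrow> (nat \<Rightarrow> vseq) \<Rightarrow> vseq" where
  "vseq_lim d X = (\<lambda>i. vec d (\<lambda>a. lim (\<lambda>n. X n i $ a)))"

lemma vseq_tendsto_lim:
  assumes "vseq_tendsto d X w"
  shows "vseq_lim d X = w"
proof (rule ext, rule eq_vecI)
  fix i
  have d: "dim_vec (w i) = d"
    using assms unfolding vseq_tendsto_def by (metis carrier_vecD)
  show "dim_vec (vseq_lim d X i) = dim_vec (w i)"
    by (simp add: vseq_lim_def d)
  fix a assume "a < dim_vec (w i)"
  then have a: "a < d" by (simp add: d)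
  then have "(\<lambda>n. X n i $ a) \<longlonglongrightarrow> w i $ a"
    using assms unfolding vseq_tendsto_def by blast
  then show "vseq_lim d X i $ a = w i $ a"
    using a by (simp add: vseq_lim_def limI)
qed

section \<open>Convex cones of vector sequences\<close>

text \<open>On vectors, \<open>0\<^sub>v d \<le> v\<close> says that \<open>v\<close> has dimension \<open>d\<close> and nonnegative entries.\<close>

definition vcone :: "nat \<Rightarrow> mseq \<Rightarrow> vseq set" where
  "vcone d K = {w. \<forall>i. 0\<^sub>v d \<le> w i \<and> w i = K i *\<^sub>v w (Suc i)}"

definition vray :: "vseq \<Rightarrow> vseq set" where
  "vray v = {\<lambda>i. t \<cdot>\<^sub>v v i | t. 0 \<le> t}"

text \<open>
  An extreme ray of a convex cone is a ray that is an extreme subset (a face):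
  if it meets the open segment between two points of the cone, it contains both points.
\<close>

definition extreme_ray :: "nat \<Rightarrow> vseq set \<Rightarrow> vseq set \<Rightarrow> bool" where
  "extreme_ray d C R \<longleftrightarrow>
     R \<subseteq> C \<and> (\<exists>v. v \<noteq> (\<lambda>i. 0\<^sub>v d) \<and> R = vray v) \<and>
     (\<forall>x\<in>C. \<forall>y\<in>C. \<forall>s. 0 < s \<and> s < 1 \<and>
        (\<lambda>i. (1 - s) \<cdot>\<^sub>v x i + s \<cdot>\<^sub>v y i) \<in> R \<longrightarrow> x \<in> R \<and> y \<in> R)"

definition extreme_vectors :: "nat \<Rightarrow> vseq set \<Rightarrow> vseq set" where
  "extreme_vectors d C = {w. w \<noteq> (\<lambda>i. 0\<^sub>v d) \<and> (\<exists>R. extreme_ray d C R \<and> w \<in> R)}"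

section \<open>Blocks\<close>

text \<open>
  The blocks are numbered \<open>1, \<dots>, L\<close> and block \<open>j\<close> has size \<open>sz j\<close>. Rows and columns
  of matrices are numbered from \<open>0\<close>, so block \<open>j\<close> consists of the indices \<open>a\<close> with
  \<open>offset sz j \<le> a < offset sz (Suc j)\<close>.
\<close>

definition offset :: "(nat \<Rightarrow> nat) \<Rightarrow> nat \<Rightarrow> nat" where
  "offset sz j = (\<Sum>m\<in>{1..<j}. sz m)"

definition total_size :: "(nat \<Rightarrow> nat) \<Rightarrow> nat \<Rightarrow> nat" where
  "total_size sz L = (\<Sum>m\<in>{1..L}. sz m)"

definition block :: "(nat \<Rightarrow> nat) \<Rightarrow> mseq \<Rightarrow> nat \<Rightarrow> nat \<Rightarrow> mseq" where
  "block sz N j k = (\<lambda>i. mat (sz j) (sz k) (\<lambda>(a, b). N i $$ (offset sz j + a, offset sz k + b)))"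

abbreviation diag_block :: "(nat \<Rightarrow> nat) \<Rightarrow> mseq \<Rightarrow> nat \<Rightarrow> mseq" where
  "diag_block sz N k \<equiv> block sz N k k"

definition block_zero :: "(nat \<Rightarrow> nat) \<Rightarrow> mseq \<Rightarrow> nat \<Rightarrow> nat \<Rightarrow> bool" where
  "block_zero sz N j k \<longleftrightarrow> (\<forall>i. block sz N j k i = 0\<^sub>m (sz j) (sz k))"

definition col_only_diag :: "(nat \<Rightarrow> nat) \<Rightarrow> nat \<Rightarrow> mseq \<Rightarrow> nat \<Rightarrow> bool" where
  "col_only_diag sz L N k \<longleftrightarrow> (\<forall>j\<in>{1..L} - {k}. block_zero sz N j k)"

definition row_only_diag :: "(nat \<Rightarrow> nat) \<Rightarrow> nat \<Rightarrow> mseq \<Rightarrow> nat \<Rightarrow> bool" where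
  "row_only_diag sz L N j \<longleftrightarrow> (\<forall>k\<in>{1..L} - {j}. block_zero sz N j k)"

text \<open>
  The last clause is the ordering of the blocks: the first \<open>p\<close> are those assigned to the kind
  whose block column is nonzero only on the diagonal, the last \<open>q\<close> those assigned to the kind whose
  block row is nonzero only on the diagonal, and the remaining ones are of neither kind.
  A block row that vanishes altogether may or may not be counted as nonzero only on the diagonal;
  both conventions are admitted, by forbidding only blocks with nonzero diagonal in the middle.
\<close>

definition frobenius_form :: "(nat \<Rightarrow> nat) \<Rightarrow> nat \<Rightarrow> mseq \<Rightarrow> bool" where
  "frobenius_form sz L N \<longleftrightarrow>
     1 \<le> L \<and> (\<forall>j\<in>{1..L}. 1 \<le> sz j) \<and>
     (\<forall>i. N i \<in> carrier_mat (total_size sz L) (total_size sz L)) \<and>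
     (\<forall>j\<in>{1..L}. \<forall>k\<in>{1..L}. k < j \<longrightarrow> block_zero sz N j k) \<and>
     (\<forall>j\<in>{1..L}. (column_reduced (diag_block sz N j) \<and> primitive_mseq (sz j) (diag_block sz N j))
                  \<or> block_zero sz N j j) \<and>
     (\<forall>j\<in>{1..L}. \<forall>k\<in>{1..L}. j < k \<longrightarrow>
        (\<forall>i i'. block sz N j k i = 0\<^sub>m (sz j) (sz k) \<longleftrightarrow> block sz N j k i' = 0\<^sub>m (sz j) (sz k))) \<and>
     (\<exists>p q. p + q \<le> L \<and>
        (\<forall>k\<in>{1..p}. col_only_diag sz L N k) \<and>
        (\<forall>k\<in>{L - q + 1..L}. row_only_diag sz L N k) \<and>
        (\<forall>k\<in>{p + 1..L - q}. \<not> block_zero sz N k k \<longrightarrow>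
            \<not> col_only_diag sz L N k \<and> \<not> row_only_diag sz L N k))"

definition embed :: "(nat \<Rightarrow> nat) \<Rightarrow> nat \<Rightarrow> nat \<Rightarrow> vseq \<Rightarrow> vseq" where
  "embed sz L k w = (\<lambda>i. vec (total_size sz L)
     (\<lambda>a. if offset sz k \<le> a \<and> a < offset sz (Suc k) then w i $ (a - offset sz k) else 0))"

definition iota :: "(nat \<Rightarrow> nat) \<Rightarrow> nat \<Rightarrow> mseq \<Rightarrow> nat \<Rightarrow> vseq \<Rightarrow> vseq" where
  "iota sz L N k w = vseq_lim (total_size sz L) (\<lambda>n. (act N ^^ n) (embed sz L k w))"

definition dist_cone :: "(nat \<Rightarrow> nat) \<Rightarrow> nat \<Rightarrow> mseq \<Rightarrow> nat \<Rightarrow> vseq set" where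
  "dist_cone sz L N k = {w \<in> vcone (sz k) (diag_block sz N k).
     vseq_convergent (total_size sz L) (\<lambda>n. (act N ^^ n) (embed sz L k w))}"

definition N_hat :: "(nat \<Rightarrow> nat) \<Rightarrow> nat \<Rightarrow> mseq \<Rightarrow> nat \<Rightarrow> mseq" where
  "N_hat sz L N k = (\<lambda>i. mat (total_size sz L) (total_size sz L)
     (\<lambda>(a, b). if a < offset sz (Suc k) \<and> b < offset sz (Suc k) then N i $$ (a, b) else 0))"

definition pi_hat :: "(nat \<Rightarrow> nat) \<Rightarrow> nat \<Rightarrow> mseq \<Rightarrow> nat \<Rightarrow> vseq \<Rightarrow> vseq" where
  "pi_hat sz L N k v = vseq_lim (total_size sz L) (\<lambda>n. (act (N_hat sz L N (k - 1)) ^^ n) v)"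

text \<open>The sum of vector sequences \<open>u 1, \<dots>, u L\<close> in \<open>\<real>\<^sup>d\<close>.\<close>

definition vseq_sum :: "nat \<Rightarrow> nat \<Rightarrow> (nat \<Rightarrow> vseq) \<Rightarrow> vseq" where
  "vseq_sum d L u = (\<lambda>i. finsum_vec TYPE(real) d (\<lambda>k. u k i) {1..L})"

definition I_map :: "(nat \<Rightarrow> nat) \<Rightarrow> nat \<Rightarrow> mseq \<Rightarrow> (nat \<Rightarrow> vseq) \<Rightarrow> vseq" where
  "I_map sz L N W = vseq_sum (total_size sz L) L (\<lambda>k. iota sz L N k (W k))"

end

theory Submission
  imports Defs
begin

text \<open>
  By triangularity the vectors that vanish outside the first \<open>k\<close> blocks form an invariant
  subspace of \<open>N\<close>, and there \<open>N\<close> and the truncation \<open>N_hat k\<close> coincide. So the fixed cone of \<open>N_hat k\<close>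
  consists of the elements of the cone of \<open>N\<close> that vanish outside the first \<open>k\<close> blocks
  (\<open>vcone_Nhat_iff\<close>), and these cones are nested.

  If \<open>v\<close> is nonnegative and fixed by \<open>N_hat k\<close>, its iterates under the entrywise smaller
  \<open>N_hat (k - 1)\<close> decrease, hence converge to some \<open>\<pi> v\<close>, which is again a fixed point.
  Vectors of the smaller cone are left unchanged, so \<open>\<pi>\<close> is a retraction and in particular
  surjective (\<open>truncation_limit\<close>, \<open>truncation_surjective\<close>).

  Let \<open>w\<close> be the \<open>k\<close>-th block of \<open>v\<close>. The difference between \<open>v\<close> and the
  embedded \<open>w\<close> lives in the first \<open>k - 1\<close> blocks, where \<open>N\<close> acts as
  \<open>N_hat (k - 1)\<close>, and \<open>N_hat (k - 1)\<close> ignores block \<open>k\<close>; so \<open>N\<^sup>n\<close> maps this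
  difference to \<open>N_hat (k - 1)\<^sup>n v\<close> for \<open>n \<ge> 1\<close>. Since \<open>N\<close> fixes \<open>v\<close>, the iterates of the embedded
  \<open>w\<close> converge to \<open>v - \<pi> v\<close>. That is, \<open>w\<close> is distinguished and
  \<open>v = \<iota> w + \<pi> v\<close> (\<open>peel_last_block\<close>). Repeating this for \<open>\<pi> v\<close> writes every element
  of the cone of \<open>N\<close> as a sum of lifts, one from each diagonal block. The summands are unique,
  because block \<open>k\<close> of \<open>\<iota> w\<close> is \<open>w\<close> itself and the later blocks of \<open>\<iota> w\<close> vanish
  (\<open>lift_supported_component\<close>, \<open>decomposition_unique\<close>).

  The cone of \<open>N\<close> is therefore linearly isomorphic to the product of the cones of distinguished
  vectors. These are pointed, and the extreme rays of a product of pointed cones are the extreme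
  rays of its factors (\<open>lift_extreme\<close>, \<open>extreme_vector_is_lift\<close>).
\<close>

section \<open>Linear and order structure of vector sequences\<close>

definition vspace :: "nat \<Rightarrow> vseq set" where
  "vspace d = {v. \<forall>i. v i \<in> carrier_vec d}"

text \<open>
  One operation serves for sums, differences and multiples, so linearity of each map is a single
  statement.
\<close>

definition vcomb :: "real \<Rightarrow> vseq \<Rightarrow> real \<Rightarrow> vseq \<Rightarrow> vseq" where
  "vcomb s x t y = (\<lambda>i. s \<cdot>\<^sub>v x i + t \<cdot>\<^sub>v y i)"

lemma vspace_dim: "v \<in> vspace d \<Longrightarrow> dim_vec (v i) = d"
  by (auto simp: vspace_def)

lemma vseq_eqI:
  assumes "x \<in> vspace d" "y \<in> vspace d" "\<And>i a. a < d \<Longrightarrow> x i $ a = y i $ a"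
  shows "x = y"
  using assms by (intro ext eq_vecI) (auto simp: vspace_dim)

lemma zero_vspace: "(\<lambda>i. 0\<^sub>v d) \<in> vspace d"
  by (simp add: vspace_def)

lemma vcomb_vspace: "x \<in> vspace d \<Longrightarrow> y \<in> vspace d \<Longrightarrow> vcomb s x t y \<in> vspace d"
  by (simp add: vspace_def vcomb_def)

lemma vcomb_index:
  "x \<in> vspace d \<Longrightarrow> y \<in> vspace d \<Longrightarrow> a < d \<Longrightarrow>
    vcomb s x t y i $ a = s * x i $ a + t * y i $ a"
  by (simp add: vcomb_def vspace_dim)

lemma act_vspace:
  assumes "\<And>i. M i \<in> carrier_mat d d"
  shows "act M v \<in> vspace d"
  unfolding vspace_def act_def using mult_mat_vec_carrier carrier_matD(1)[OF assms]
  by (auto intro!: carrier_vecI)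

lemma act_power_vspace:
  assumes "\<And>i. M i \<in> carrier_mat d d" "v \<in> vspace d"
  shows "(act M ^^ n) v \<in> vspace d"
  using assms act_vspace by (cases n) auto

lemma act_index:
  assumes "\<And>i. M i \<in> carrier_mat d d" "v \<in> vspace d" "a < d"
  shows "act M v i $ a = (\<Sum>b<d. M i $$ (a, b) * v (Suc i) $ b)"
proof -
  have "dim_row (M i) = d" "dim_col (M i) = d"
    using assms(1)[of i] by auto
  then show ?thesis
    using assms(2,3) by (simp add: act_def scalar_prod_def vspace_dim atLeast0LessThan)
qed

lemma act_vcomb:
  assumes "\<And>i. M i \<in> carrier_mat d d" "x \<in> vspace d" "y \<in> vspace d"
  shows "act M (vcomb s x t y) = vcomb s (act M x) t (act M y)"
proof (rule vseq_eqI[of _ d])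
  fix i a assume a: "a < d"
  show "act M (vcomb s x t y) i $ a = vcomb s (act M x) t (act M y) i $ a"
    using a assms(2,3)
    by (simp add: act_index[OF assms(1)] vcomb_vspace vcomb_index[of _ d] act_vspace[OF assms(1)]
        sum_distrib_left sum.distrib algebra_simps)
qed (simp_all add: act_vspace[OF assms(1)] vcomb_vspace)

lemma act_power_vcomb:
  assumes "\<And>i. M i \<in> carrier_mat d d" "x \<in> vspace d" "y \<in> vspace d"
  shows "(act M ^^ n) (vcomb s x t y) = vcomb s ((act M ^^ n) x) t ((act M ^^ n) y)"
  by (induction n)
    (simp_all add: act_vcomb[OF assms(1)] act_power_vspace[OF assms(1)] assms(2,3))

lemma act_power_fixed: "act M v = v \<Longrightarrow> (act M ^^ n) v = v"
  by (induction n) simp_all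

lemma vcone_iff:
  "v \<in> vcone d M \<longleftrightarrow>
    v \<in> vspace d \<and> (\<forall>i. \<forall>a<d. 0 \<le> v i $ a) \<and> act M v = v"
proof -
  have "act M v = v \<longleftrightarrow> (\<forall>i. v i = M i *\<^sub>v v (Suc i))"
    unfolding act_def fun_eq_iff by metis
  moreover have "0\<^sub>v d \<le> v i \<longleftrightarrow> v i \<in> carrier_vec d \<and> (\<forall>a<d. 0 \<le> v i $ a)" for i
    by (auto simp: less_eq_vec_def)
  ultimately show ?thesis
    unfolding vcone_def vspace_def by blast
qed

lemma vcone_vspace: "v \<in> vcone d M \<Longrightarrow> v \<in> vspace d"
  by (simp add: vcone_iff)

lemma vcone_vcomb:
  assumes "\<And>i. M i \<in> carrier_mat d d" "x \<in> vcone d M" "y \<in> vcone d M" "0 \<le> s" "0 \<le> t"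
  shows "vcomb s x t y \<in> vcone d M"
  using assms(2-) by (auto simp: vcone_iff vcomb_vspace vcomb_index[of _ d] act_vcomb[OF assms(1)])

lemma zero_vcone:
  assumes "\<And>i. M i \<in> carrier_mat d d"
  shows "(\<lambda>i. 0\<^sub>v d) \<in> vcone d M"
proof -
  have "act M (\<lambda>i. 0\<^sub>v d) = (\<lambda>i. 0\<^sub>v d)"
    by (rule vseq_eqI[of _ d])
      (simp_all add: act_vspace[OF assms] zero_vspace act_index[OF assms zero_vspace])
  then show ?thesis
    by (simp add: vcone_iff zero_vspace)
qed

lemma scaled_eq_vcomb: "v \<in> vspace d \<Longrightarrow> (\<lambda>i. t \<cdot>\<^sub>v v i) = vcomb t v 0 v"
  by (rule vseq_eqI[of _ d])
    (simp_all add: vcomb_vspace vcomb_index[of _ d] vspace_dim, simp add: vspace_def)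

lemma nonneg_vcomb_eq_zeroD:
  assumes "x \<in> vspace d" "y \<in> vspace d"
    and "\<And>i a. a < d \<Longrightarrow> 0 \<le> x i $ a" "\<And>i a. a < d \<Longrightarrow> 0 \<le> y i $ a"
    and "0 < s" "0 < t" "vcomb s x t y = (\<lambda>i. 0\<^sub>v d)"
  shows "x = (\<lambda>i. 0\<^sub>v d)" "y = (\<lambda>i. 0\<^sub>v d)"
proof -
  have "x i $ a = 0 \<and> y i $ a = 0" if a: "a < d" for i a
  proof -
    have "s * x i $ a + t * y i $ a = 0"
      using arg_cong[OF assms(7), of "\<lambda>z. z i $ a"] a assms(1,2) by (simp add: vcomb_index)
    moreover have "0 \<le> s * x i $ a" "0 \<le> t * y i $ a"
      using assms a by simp_all
    ultimately have "s * x i $ a = 0" "t * y i $ a = 0"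
      by linarith+
    then show ?thesis
      using assms(5,6) by simp
  qed
  then show "x = (\<lambda>i. 0\<^sub>v d)" "y = (\<lambda>i. 0\<^sub>v d)"
    by (auto intro!: vseq_eqI[of _ d] simp: assms(1,2) zero_vspace)
qed

text \<open>
  All nonzero vectors of a ray span it, so extremality can be tested on the ray of the vector
  itself.
\<close>

lemma extreme_vectors_iff:
  assumes C: "C \<subseteq> vspace d" and scale: "\<And>v t. v \<in> C \<Longrightarrow> 0 \<le> t \<Longrightarrow> (\<lambda>i. t \<cdot>\<^sub>v v i) \<in> C"
  shows "w \<in> extreme_vectors d C \<longleftrightarrow>
    w \<in> C \<and> w \<noteq> (\<lambda>i. 0\<^sub>v d) \<and>
    (\<forall>x\<in>C. \<forall>y\<in>C. \<forall>s. 0 < s \<and> s < 1 \<and> vcomb (1 - s) x s y \<in> vray w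
      \<longrightarrow> x \<in> vray w \<and> y \<in> vray w)" (is "_ \<longleftrightarrow> ?R")
proof
  assume "w \<in> extreme_vectors d C"
  then obtain v where w0: "w \<noteq> (\<lambda>i. 0\<^sub>v d)" and ext: "extreme_ray d C (vray v)"
    and wv: "w \<in> vray v"
    by (auto simp: extreme_vectors_def extreme_ray_def)
  have "v \<in> vray v"
    by (auto simp: vray_def intro!: exI[of _ 1])
  then have vC: "v \<in> vspace d"
    using ext C by (auto simp: extreme_ray_def)
  obtain t where t: "0 \<le> t" "w = (\<lambda>i. t \<cdot>\<^sub>v v i)"
    using wv by (auto simp: vray_def)
  have "t \<noteq> 0"
  proof
    assume "t = 0"
    then have "w = (\<lambda>i. 0\<^sub>v d)"
      using vC t(2) by (auto simp: fun_eq_iff vspace_dim intro!: eq_vecI)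
    with w0 show False ..
  qed
  have "vray w = vray v"
  proof (intro equalityI subsetI)
    fix z assume "z \<in> vray w"
    then obtain r where "0 \<le> r" "z = (\<lambda>i. r \<cdot>\<^sub>v w i)"
      by (auto simp: vray_def)
    then show "z \<in> vray v"
      using t by (auto simp: vray_def smult_smult_assoc intro!: exI[of _ "r * t"])
  next
    fix z assume "z \<in> vray v"
    then obtain r where "0 \<le> r" "z = (\<lambda>i. r \<cdot>\<^sub>v v i)"
      by (auto simp: vray_def)
    then show "z \<in> vray w"
      using t \<open>t \<noteq> 0\<close> by (auto simp: vray_def smult_smult_assoc intro!: exI[of _ "r / t"])
  qed
  then show ?R
    using w0 ext wv by (auto simp: extreme_ray_def vcomb_def)
next
  assume R: ?R
  have "w \<in> vray w"
    by (auto simp: vray_def intro!: exI[of _ 1])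
  moreover have "vray w \<subseteq> C"
    using R scale by (auto simp: vray_def)
  ultimately show "w \<in> extreme_vectors d C"
    using R unfolding extreme_vectors_def extreme_ray_def vcomb_def by blast
qed

section \<open>Limits of iterates\<close>

lemma vseq_tendsto_iff:
  "vseq_tendsto d X w \<longleftrightarrow>
    w \<in> vspace d \<and> (\<forall>i. \<forall>a<d. (\<lambda>n. X n i $ a) \<longlonglongrightarrow> w i $ a)"
  by (auto simp: vseq_tendsto_def vspace_def)

lemma vseq_tendsto_vcomb:
  assumes "vseq_tendsto d X x" "vseq_tendsto d Y y"
    and "\<And>n. X n \<in> vspace d" "\<And>n. Y n \<in> vspace d"
  shows "vseq_tendsto d (\<lambda>n. vcomb s (X n) t (Y n)) (vcomb s x t y)"
  using assms
  by (auto simp: vseq_tendsto_iff vcomb_vspace vcomb_index[of _ d] intro!: tendsto_add tendsto_mult_left)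

text \<open>
  The action is continuous because each coordinate of \<open>act M v\<close> depends on finitely many
  coordinates of \<open>v\<close>; hence a limit of iterates is a fixed point.
\<close>

lemma limit_of_iterates_in_vcone:
  assumes M: "\<And>i. M i \<in> carrier_mat d d"
    and nonneg: "\<And>i a b. a < d \<Longrightarrow> b < d \<Longrightarrow> 0 \<le> M i $$ (a, b)"
    and v: "v \<in> vspace d" "\<And>i a. a < d \<Longrightarrow> 0 \<le> v i $ a"
    and lim: "vseq_tendsto d (\<lambda>n. (act M ^^ n) v) w"
  shows "w \<in> vcone d M"
proof -
  have w: "w \<in> vspace d"
    and limD: "\<And>i a. a < d \<Longrightarrow> (\<lambda>n. (act M ^^ n) v i $ a) \<longlonglongrightarrow> w i $ a"
    using lim by (auto simp: vseq_tendsto_iff)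
  have pos: "0 \<le> (act M ^^ n) v i $ a" if "a < d" for n i a
    using that
    by (induction n arbitrary: i a)
      (auto simp: v act_index[OF M] act_power_vspace[OF M v(1)] nonneg intro!: sum_nonneg)
  have "act M w = w"
  proof (rule vseq_eqI[of _ d])
    fix i a assume a: "a < d"
    have "(\<lambda>n. act M ((act M ^^ n) v) i $ a) \<longlonglongrightarrow> act M w i $ a"
      unfolding act_index[OF M act_power_vspace[OF M v(1)] a] act_index[OF M w a]
      by (intro tendsto_intros limD) simp
    moreover have "(\<lambda>n. act M ((act M ^^ n) v) i $ a) \<longlonglongrightarrow> w i $ a"
      using LIMSEQ_Suc[OF limD[OF a]] by simp
    ultimately show "act M w i $ a = w i $ a"
      by (rule LIMSEQ_unique)
  qed (simp_all add: w act_vspace[OF M])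
  moreover have "0 \<le> w i $ a" if "a < d" for i a
    using pos[OF that] by (intro LIMSEQ_le_const[OF limD[OF that]]) auto
  ultimately show ?thesis
    by (simp add: vcone_iff w)
qed

text \<open>
  If \<open>M \<le> M'\<close>, then \<open>M v \<le> M' v = v\<close>, so the iterates of a nonnegative \<open>M\<close> on \<open>v\<close> decrease;
  being nonnegative, they converge.
\<close>

lemma iterates_of_smaller_mseq_convergent:
  assumes M: "\<And>i. M i \<in> carrier_mat d d" and M': "\<And>i. M' i \<in> carrier_mat d d"
    and nonneg: "\<And>i a b. a < d \<Longrightarrow> b < d \<Longrightarrow> 0 \<le> M i $$ (a, b)"
    and le: "\<And>i a b. a < d \<Longrightarrow> b < d \<Longrightarrow> M i $$ (a, b) \<le> M' i $$ (a, b)"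
    and v: "v \<in> vcone d M'"
  shows "vseq_convergent d (\<lambda>n. (act M ^^ n) v)"
proof -
  have sp: "v \<in> vspace d" and v0: "\<And>i a. a < d \<Longrightarrow> 0 \<le> v i $ a" and fixed: "act M' v = v"
    using v by (auto simp: vcone_iff)
  note it = act_power_vspace[OF M sp]
  have pos: "0 \<le> (act M ^^ n) v i $ a" if "a < d" for n i a
    using that
    by (induction n arbitrary: i a)
      (auto simp: v0 act_index[OF M] it nonneg intro!: sum_nonneg)
  have dec: "(act M ^^ Suc n) v i $ a \<le> (act M ^^ n) v i $ a" if "a < d" for n i a
    using that
  proof (induction n arbitrary: i a)
    case 0
    have "act M v i $ a \<le> act M' v i $ a"
      using 0 by (auto simp: act_index[OF M sp] act_index[OF M' sp] le v0
          intro!: sum_mono mult_right_mono)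
    then show ?case
      by (simp add: fixed)
  next
    case (Suc n)
    have "act M ((act M ^^ Suc n) v) i $ a \<le> act M ((act M ^^ n) v) i $ a"
      unfolding act_index[OF M it Suc.prems]
      by (intro sum_mono mult_left_mono Suc.IH nonneg Suc.prems) auto
    then show ?case
      by simp
  qed
  have "convergent (\<lambda>n. (act M ^^ n) v i $ a)" if a: "a < d" for i a
  proof -
    have "decseq (\<lambda>n. (act M ^^ n) v i $ a)"
      using dec a by (intro decseq_SucI) simp
    then obtain c where "(\<lambda>n. (act M ^^ n) v i $ a) \<longlonglongrightarrow> c"
      using decseq_convergent[of "\<lambda>n. (act M ^^ n) v i $ a" 0] pos[OF a] by metis
    then show ?thesis
      by (rule convergentI)
  qed
  then have "vseq_tendsto d (\<lambda>n. (act M ^^ n) v) (vseq_lim d (\<lambda>n. (act M ^^ n) v))"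
    by (auto simp: vseq_tendsto_iff vseq_lim_def vspace_def convergent_LIMSEQ_iff)
  then show ?thesis
    by (auto simp: vseq_convergent_def)
qed

section \<open>Finite sums of vector sequences\<close>

lemma vseq_sum_vspace:
  assumes "\<forall>k\<in>{1..L}. u k \<in> vspace d"
  shows "vseq_sum d L u \<in> vspace d"
  using assms by (auto simp: vseq_sum_def vspace_def intro!: finsum_vec_closed)

lemma vseq_sum_index:
  assumes "\<forall>k\<in>{1..L}. u k \<in> vspace d" "a < d"
  shows "vseq_sum d L u i $ a = (\<Sum>k=1..L. u k i $ a)"
  using assms by (auto simp: vseq_sum_def vspace_def intro!: index_finsum_vec)

lemma vseq_sum_cong:
  assumes "\<forall>k\<in>{1..L}. u k \<in> vspace d" "\<forall>k\<in>{1..L}. u k = u' k"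
  shows "vseq_sum d L u = vseq_sum d L u'"
  using assms by (intro vseq_eqI[of _ d]) (auto simp: vseq_sum_vspace vseq_sum_index)

lemma vseq_sum_Suc:
  assumes "\<forall>k\<in>{1..Suc L}. u k \<in> vspace d"
  shows "vseq_sum d (Suc L) u = vcomb 1 (vseq_sum d L u) 1 (u (Suc L))"
  using assms
  by (intro vseq_eqI[of _ d]) (auto simp: vseq_sum_vspace vseq_sum_index vcomb_vspace vcomb_index[of _ d])

lemma vseq_sum_0: "vseq_sum d 0 u = (\<lambda>i. 0\<^sub>v d)"
  by (rule vseq_eqI[of _ d]) (simp_all add: vseq_sum_vspace vseq_sum_index zero_vspace)

lemma vseq_sum_vcomb:
  assumes "\<forall>k\<in>{1..L}. u k \<in> vspace d" "\<forall>k\<in>{1..L}. u' k \<in> vspace d"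
  shows "vseq_sum d L (\<lambda>k. vcomb s (u k) t (u' k)) = vcomb s (vseq_sum d L u) t (vseq_sum d L u')"
  using assms
  by (intro vseq_eqI[of _ d])
    (auto simp: vseq_sum_vspace vseq_sum_index vcomb_vspace vcomb_index[of _ d] sum_distrib_left sum.distrib)

lemma vseq_sum_vcone:
  assumes "\<And>i. M i \<in> carrier_mat d d" "\<forall>k\<in>{1..L}. u k \<in> vcone d M"
  shows "vseq_sum d L u \<in> vcone d M"
  using assms(2)
proof (induction L)
  case 0
  then show ?case
    by (simp add: vseq_sum_0 zero_vcone[OF assms(1)])
next
  case (Suc L)
  then have "vseq_sum d L u \<in> vcone d M" "u (Suc L) \<in> vcone d M"
    by simp_all
  moreover have "\<forall>k\<in>{1..Suc L}. u k \<in> vspace d"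
    using Suc.prems vcone_vspace by blast
  ultimately show ?case
    by (simp only: vseq_sum_Suc) (simp add: vcone_vcomb[OF assms(1)])
qed

lemma vseq_sum_single:
  assumes "k \<in> {1..L}" "u k \<in> vspace d" "\<forall>j\<in>{1..L} - {k}. u j = (\<lambda>i. 0\<^sub>v d)"
  shows "vseq_sum d L u = u k"
proof (rule vseq_eqI[of _ d])
  have sp: "\<forall>j\<in>{1..L}. u j \<in> vspace d"
  proof
    fix j assume "j \<in> {1..L}"
    then show "u j \<in> vspace d"
      using assms by (cases "j = k") (simp_all add: zero_vspace)
  qed
  then show "vseq_sum d L u \<in> vspace d" "u k \<in> vspace d"
    by (simp_all add: vseq_sum_vspace assms)
  fix i a assume a: "a < d"
  have "(\<Sum>j=1..L. u j i $ a) = (\<Sum>j\<in>{k}. u j i $ a)"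
    using assms(1,3) a by (intro sum.mono_neutral_right) auto
  then show "vseq_sum d L u i $ a = u k i $ a"
    using sp a by (simp add: vseq_sum_index)
qed

section \<open>Block coordinates\<close>

lemma offset_Suc: "1 \<le> j \<Longrightarrow> offset sz (Suc j) = offset sz j + sz j"
  by (simp add: offset_def)

lemma offset_mono: "j \<le> k \<Longrightarrow> offset sz j \<le> offset sz k"
  unfolding offset_def by (rule sum_mono2) auto

lemma total_size_eq_offset: "total_size sz L = offset sz (Suc L)"
  by (simp add: total_size_def offset_def atLeastLessThanSuc_atLeastAtMost)

lemma coordinate_in_block:
  assumes "a < offset sz (Suc L)"
  shows "\<exists>j\<in>{1..L}. offset sz j \<le> a \<and> a < offset sz (Suc j)"
  using assms
proof (induction L)
  case 0
  then show ?case
    by (simp add: offset_def)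
next
  case (Suc L)
  show ?case
  proof (cases "a < offset sz (Suc L)")
    case True
    with Suc.IH show ?thesis
      by force
  next
    case False
    with Suc.prems show ?thesis
      by (intro bexI[of _ "Suc L"]) auto
  qed
qed

definition supported :: "(nat \<Rightarrow> nat) \<Rightarrow> nat \<Rightarrow> nat \<Rightarrow> vseq \<Rightarrow> bool" where
  "supported sz L k v \<longleftrightarrow>
    (\<forall>i a. offset sz (Suc k) \<le> a \<longrightarrow> a < total_size sz L \<longrightarrow> v i $ a = 0)"

definition component :: "(nat \<Rightarrow> nat) \<Rightarrow> nat \<Rightarrow> vseq \<Rightarrow> vseq" where
  "component sz k v = (\<lambda>i. vec (sz k) (\<lambda>a. v i $ (offset sz k + a)))"

lemma component_vspace: "component sz k v \<in> vspace (sz k)"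
  by (simp add: component_def vspace_def)

lemma embed_vspace: "embed sz L k x \<in> vspace (total_size sz L)"
  by (simp add: embed_def vspace_def)

lemma embed_supported: "supported sz L k (embed sz L k x)"
  by (simp add: embed_def supported_def)

lemma embed_vcomb:
  assumes "x \<in> vspace (sz k)" "y \<in> vspace (sz k)" "1 \<le> k"
  shows "embed sz L k (vcomb s x t y) = vcomb s (embed sz L k x) t (embed sz L k y)"
proof (rule vseq_eqI[of _ "total_size sz L"])
  fix i a assume a: "a < total_size sz L"
  have "a - offset sz k < sz k" if "offset sz k \<le> a" "a < offset sz (Suc k)"
    using that assms(3) by (simp add: offset_Suc)
  then show "embed sz L k (vcomb s x t y) i $ a = vcomb s (embed sz L k x) t (embed sz L k y) i $ a"
    unfolding vcomb_index[OF embed_vspace embed_vspace a]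
    using a assms(1,2) by (auto simp: embed_def vcomb_index[of _ "sz k"])
qed (simp_all add: vcomb_vspace embed_vspace)

section \<open>Block upper triangular matrix sequences\<close>

locale nonneg_block_triangular =
  fixes N :: mseq and sz :: "nat \<Rightarrow> nat" and L :: nat and l :: nat
  assumes l_def: "l = total_size sz L"
    and N_carrier: "\<And>i. N i \<in> carrier_mat l l"
    and N_nonneg: "\<And>i a b. a < l \<Longrightarrow> b < l \<Longrightarrow> 0 \<le> N i $$ (a, b)"
    and lower_block_zero: "\<And>j k. j \<in> {1..L} \<Longrightarrow> k \<in> {1..L} \<Longrightarrow> k < j \<Longrightarrow> block_zero sz N j k"
begin

abbreviation "Nhat k \<equiv> N_hat sz L N k"
abbreviation "A k \<equiv> diag_block sz N k"
abbreviation "dcone k \<equiv> dist_cone sz L N k"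
abbreviation "lift k \<equiv> iota sz L N k"
abbreviation "spt k \<equiv> supported sz L k"
abbreviation "blk k \<equiv> component sz k"

lemma offset_le_l: "k \<le> L \<Longrightarrow> offset sz (Suc k) \<le> l"
  unfolding l_def total_size_eq_offset by (rule offset_mono) simp

text \<open>
  Every coordinate belongs to some block, so the vanishing lower blocks cover all entries in rows
  beyond the first \<open>j\<close> blocks and columns within them.
\<close>

lemma lower_entry_zero:
  assumes a: "a < l" "offset sz (Suc j) \<le> a" and b: "b < offset sz (Suc j)" and j: "j \<le> L"
  shows "N i $$ (a, b) = 0"
proof -
  obtain m where m: "m \<in> {1..L}" "offset sz m \<le> a" "a < offset sz (Suc m)"
    using coordinate_in_block a(1) unfolding l_def total_size_eq_offset by blast
  obtain n where n: "n \<in> {1..j}" "offset sz n \<le> b" "b < offset sz (Suc n)"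
    using coordinate_in_block b by blast
  have "\<not> m \<le> j"
    using offset_mono[of "Suc m" "Suc j" sz] a m by auto
  then have "block sz N m n i $$ (a - offset sz m, b - offset sz n)
      = 0\<^sub>m (sz m) (sz n) $$ (a - offset sz m, b - offset sz n)"
    using lower_block_zero[of m n] m n j by (simp add: block_zero_def)
  moreover have "a - offset sz m < sz m" "b - offset sz n < sz n"
    using m n by (auto simp: offset_Suc)
  ultimately show ?thesis
    using m n by (simp add: block_def)
qed

lemma A_carrier: "A k i \<in> carrier_mat (sz k) (sz k)"
  by (simp add: block_def)

lemma Nhat_carrier: "Nhat k i \<in> carrier_mat l l"
  by (simp add: N_hat_def l_def)

lemma Nhat_index:
  "a < l \<Longrightarrow> b < l \<Longrightarrow> Nhat k i $$ (a, b) =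
    (if a < offset sz (Suc k) \<and> b < offset sz (Suc k) then N i $$ (a, b) else 0)"
  by (simp add: N_hat_def l_def)

lemma act_Nhat_supported:
  assumes "v \<in> vspace l"
  shows "spt k (act (Nhat k) v)"
  using assms
  by (auto simp: supported_def act_index[OF Nhat_carrier] Nhat_index l_def[symmetric])

lemma act_Nhat_eq_act:
  assumes v: "v \<in> vspace l" "spt k v" and k: "k \<le> L"
  shows "act (Nhat k) v = act N v"
proof (rule vseq_eqI[of _ l])
  fix i a assume a: "a < l"
  have *: "Nhat k i $$ (a, b) * v (Suc i) $ b = N i $$ (a, b) * v (Suc i) $ b" if b: "b < l" for b
  proof (cases "b < offset sz (Suc k)")
    case True
    then show ?thesis
      using a b lower_entry_zero[of a k b i] k by (auto simp: Nhat_index)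
  next
    case False
    then show ?thesis
      using b v(2) by (simp add: supported_def l_def[symmetric])
  qed
  show "act (Nhat k) v i $ a = act N v i $ a"
    unfolding act_index[OF Nhat_carrier v(1) a] act_index[OF N_carrier v(1) a]
    by (intro sum.cong refl, rule *) simp
qed (simp_all add: act_vspace Nhat_carrier N_carrier)

lemma act_Nhat_cong:
  assumes "v \<in> vspace l" "v' \<in> vspace l"
    and "\<And>i b. b < offset sz (Suc k) \<Longrightarrow> b < l \<Longrightarrow> v i $ b = v' i $ b"
  shows "act (Nhat k) v = act (Nhat k) v'"
  using assms
  by (intro vseq_eqI[of _ l])
    (auto simp: act_vspace[OF Nhat_carrier] act_index[OF Nhat_carrier] Nhat_index intro!: sum.cong)

text \<open>
  By triangularity, the first \<open>k\<close> blocks span a subspace invariant under \<open>N\<close>, on which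
  \<open>N\<close> and its truncation agree. So the cones of the truncations form an increasing chain inside the
  cone of \<open>N\<close>.
\<close>

lemma vcone_Nhat_iff:
  assumes "k \<le> L"
  shows "v \<in> vcone l (Nhat k) \<longleftrightarrow> v \<in> vcone l N \<and> spt k v"
  using act_Nhat_supported[of v k] act_Nhat_eq_act[of v k] assms by (auto simp: vcone_iff)

lemma supported_mono: "spt j v \<Longrightarrow> j \<le> k \<Longrightarrow> spt k v"
  using offset_mono[of "Suc j" "Suc k" sz] by (auto simp: supported_def)

lemma act_supported: "v \<in> vspace l \<Longrightarrow> spt k v \<Longrightarrow> k \<le> L \<Longrightarrow> spt k (act N v)"
  using act_Nhat_supported[of v k] act_Nhat_eq_act[of v k] by simp

lemma component_act:
  assumes v: "v \<in> vspace l" "spt k v" and k: "k \<in> {1..L}"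
  shows "blk k (act N v) = act (A k) (blk k v)"
proof (rule vseq_eqI[of _ "sz k"])
  fix i a assume a: "a < sz k"
  let ?o = "offset sz k"
  have o: "?o + sz k \<le> l" "offset sz (Suc k) = ?o + sz k" "offset sz (Suc (k - 1)) = ?o"
    using offset_le_l[of k] k by (auto simp: offset_Suc)
  have "act N v i $ (?o + a) = (\<Sum>b<l. N i $$ (?o + a, b) * v (Suc i) $ b)"
    using a o by (intro act_index[OF N_carrier v(1)]) simp
  also have "\<dots> = (\<Sum>b\<in>{?o..<?o + sz k}. N i $$ (?o + a, b) * v (Suc i) $ b)"
  proof (rule sum.mono_neutral_right)
    show "\<forall>b\<in>{..<l} - {?o..<?o + sz k}. N i $$ (?o + a, b) * v (Suc i) $ b = 0"
    proof
      fix b assume b: "b \<in> {..<l} - {?o..<?o + sz k}"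
      show "N i $$ (?o + a, b) * v (Suc i) $ b = 0"
      proof (cases "b < ?o")
        case True
        then show ?thesis
          using lower_entry_zero[of "?o + a" "k - 1" b i] a o k by auto
      next
        case False
        then show ?thesis
          using v(2) b o by (simp add: supported_def l_def[symmetric])
      qed
    qed
  qed (use o in auto)
  also have "\<dots> = (\<Sum>b<sz k. N i $$ (?o + a, ?o + b) * v (Suc i) $ (?o + b))"
    by (simp add: sum.atLeastLessThan_shift_0 atLeast0LessThan comp_def)
  also have "\<dots> = act (A k) (blk k v) i $ a"
    unfolding act_index[of "A k" "sz k", OF A_carrier[of k] component_vspace[of sz k] a]
    using a by (simp add: block_def component_def)
  finally show "blk k (act N v) i $ a = act (A k) (blk k v) i $ a"
    using a by (simp add: component_def)
qed (simp_all add: component_vspace act_vspace[OF A_carrier])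

lemma component_embed:
  assumes "x \<in> vspace (sz k)" "k \<in> {1..L}"
  shows "blk k (embed sz L k x) = x"
  using assms offset_le_l[of k]
  by (intro vseq_eqI[of _ "sz k"])
    (auto simp: component_vspace, auto simp: component_def embed_def offset_Suc l_def)

lemma component_vcone:
  assumes v: "v \<in> vcone l N" "spt k v" and k: "k \<in> {1..L}"
  shows "blk k v \<in> vcone (sz k) (A k)"
proof -
  have "act (A k) (blk k v) = blk k v"
    using component_act[of v k] assms by (simp add: vcone_iff)
  moreover have "0 \<le> blk k v i $ a" if "a < sz k" for i a
    using that v(1) k offset_le_l[of k] by (simp add: vcone_iff component_def offset_Suc)
  ultimately show ?thesis
    by (simp add: vcone_iff component_vspace)
qed

section \<open>The lift of a vector of a diagonal block\<close>

lemma dist_vspace: "x \<in> dcone k \<Longrightarrow> x \<in> vspace (sz k)"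
  by (simp add: dist_cone_def vcone_iff)

lemma dist_nonneg: "x \<in> dcone k \<Longrightarrow> a < sz k \<Longrightarrow> 0 \<le> x i $ a"
  by (simp add: dist_cone_def vcone_iff)

lemma embed_vspace_l: "embed sz L k x \<in> vspace l"
  by (simp add: embed_vspace l_def)

lemma lift_tendsto:
  "x \<in> dcone k \<Longrightarrow> vseq_tendsto l (\<lambda>n. (act N ^^ n) (embed sz L k x)) (lift k x)"
  using vseq_tendsto_lim
  by (fastforce simp: dist_cone_def iota_def vseq_convergent_def l_def)

lemma lift_eqI:
  assumes "x \<in> vcone (sz k) (A k)" "vseq_tendsto l (\<lambda>n. (act N ^^ n) (embed sz L k x)) w"
  shows "x \<in> dcone k" "lift k x = w"
  using assms vseq_tendsto_lim[OF assms(2)]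
  by (auto simp: dist_cone_def iota_def vseq_convergent_def l_def)

lemma iterate_embed:
  assumes "x \<in> vcone (sz k) (A k)" "k \<in> {1..L}"
  shows "spt k ((act N ^^ n) (embed sz L k x)) \<and> blk k ((act N ^^ n) (embed sz L k x)) = x"
proof (induction n)
  case 0
  then show ?case
    using assms by (simp add: embed_supported component_embed vcone_iff)
next
  case (Suc n)
  then show ?case
    using assms act_power_vspace[OF N_carrier embed_vspace_l]
    by (simp add: act_supported component_act vcone_iff)
qed

lemma lift_vcone:
  assumes "x \<in> dcone k" "k \<in> {1..L}"
  shows "lift k x \<in> vcone l N"
proof (rule limit_of_iterates_in_vcone[OF N_carrier N_nonneg _ _ lift_tendsto[OF assms(1)]])
  show "0 \<le> embed sz L k x i $ a" if "a < l" for i a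
    using that assms dist_nonneg[OF assms(1)] by (auto simp: embed_def l_def offset_Suc)
qed (simp_all add: embed_vspace_l)

text \<open>
  In block \<open>k\<close> the iterates are constant: there \<open>N\<close> acts by its diagonal block, which fixes
  \<open>x\<close>. So \<open>x\<close> can be read off from its lift.
\<close>

lemma lift_supported_component:
  assumes x: "x \<in> dcone k" and k: "k \<in> {1..L}"
  shows "spt k (lift k x)" "blk k (lift k x) = x"
proof -
  have xc: "x \<in> vcone (sz k) (A k)"
    using x by (simp add: dist_cone_def)
  have lim: "(\<lambda>n. (act N ^^ n) (embed sz L k x) i $ a) \<longlonglongrightarrow> lift k x i $ a" if "a < l" for i a
    using lift_tendsto[OF x] that by (simp add: vseq_tendsto_iff)
  show "spt k (lift k x)"
    unfolding supported_def
  proof (intro allI impI)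
    fix i a assume a: "offset sz (Suc k) \<le> a" "a < total_size sz L"
    then have "(act N ^^ n) (embed sz L k x) i $ a = 0" for n
      using iterate_embed[OF xc k] by (auto simp: supported_def)
    with lim[of a i] a show "lift k x i $ a = 0"
      by (simp add: l_def LIMSEQ_const_iff)
  qed
  show "blk k (lift k x) = x"
  proof (rule vseq_eqI[of _ "sz k"])
    fix i a assume a: "a < sz k"
    have "(act N ^^ n) (embed sz L k x) i $ (offset sz k + a)
        = blk k ((act N ^^ n) (embed sz L k x)) i $ a" for n
      using a by (simp add: component_def)
    then have "(act N ^^ n) (embed sz L k x) i $ (offset sz k + a) = x i $ a" for n
      using iterate_embed[OF xc k] by simp
    moreover have "offset sz k + a < l"
      using a k offset_le_l[of k] by (simp add: offset_Suc)
    ultimately have "lift k x i $ (offset sz k + a) = x i $ a"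
      using lim[of "offset sz k + a" i] by (simp add: LIMSEQ_const_iff)
    then show "blk k (lift k x) i $ a = x i $ a"
      using a by (simp add: component_def)
  qed (simp_all add: component_vspace dist_vspace[OF x])
qed

lemma lift_vspace: "x \<in> dcone k \<Longrightarrow> k \<in> {1..L} \<Longrightarrow> lift k x \<in> vspace l"
  using lift_vcone vcone_vspace by blast

lemma lift_inj: "x \<in> dcone k \<Longrightarrow> y \<in> dcone k \<Longrightarrow> k \<in> {1..L} \<Longrightarrow> lift k x = lift k y \<Longrightarrow> x = y"
  using lift_supported_component(2) by metis

lemma dist_vcomb:
  assumes x: "x \<in> dcone k" and y: "y \<in> dcone k" and k: "k \<in> {1..L}" and st: "0 \<le> s" "0 \<le> t"
  shows "vcomb s x t y \<in> dcone k" "lift k (vcomb s x t y) = vcomb s (lift k x) t (lift k y)"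
proof -
  have "vcomb s x t y \<in> vcone (sz k) (A k)"
    using x y by (intro vcone_vcomb[OF A_carrier _ _ st]) (simp_all add: dist_cone_def)
  moreover have "(act N ^^ n) (embed sz L k (vcomb s x t y)) =
      vcomb s ((act N ^^ n) (embed sz L k x)) t ((act N ^^ n) (embed sz L k y))" for n
    using k by (simp add: embed_vcomb dist_vspace x y act_power_vcomb[OF N_carrier] embed_vspace_l)
  then have "vseq_tendsto l (\<lambda>n. (act N ^^ n) (embed sz L k (vcomb s x t y)))
      (vcomb s (lift k x) t (lift k y))"
    by (simp add: vseq_tendsto_vcomb lift_tendsto x y act_power_vspace[OF N_carrier] embed_vspace_l)
  ultimately show "vcomb s x t y \<in> dcone k" "lift k (vcomb s x t y) = vcomb s (lift k x) t (lift k y)"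
    by (rule lift_eqI)+
qed

lemma dist_scale:
  assumes "x \<in> dcone k" "k \<in> {1..L}" "0 \<le> t"
  shows "(\<lambda>i. t \<cdot>\<^sub>v x i) \<in> dcone k" "lift k (\<lambda>i. t \<cdot>\<^sub>v x i) = (\<lambda>i. t \<cdot>\<^sub>v lift k x i)"
  using dist_vcomb[of x k x t 0] assms
  by (simp_all add: scaled_eq_vcomb[OF dist_vspace] scaled_eq_vcomb[OF lift_vspace])

lemma dist_zero:
  "(\<lambda>i. 0\<^sub>v (sz k)) \<in> dcone k" "lift k (\<lambda>i. 0\<^sub>v (sz k)) = (\<lambda>i. 0\<^sub>v l)"
proof -
  have "embed sz L k (\<lambda>i. 0\<^sub>v (sz k)) = (\<lambda>i. 0\<^sub>v l)"
  proof (rule vseq_eqI[of _ l])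
    fix i a assume "a < l"
    moreover have "a - offset sz k < sz k" if "offset sz k \<le> a" "a < offset sz (Suc k)"
      using that by (cases "k = 0") (simp_all add: offset_Suc, simp add: offset_def)
    ultimately show "embed sz L k (\<lambda>i. 0\<^sub>v (sz k)) i $ a = 0\<^sub>v l $ a"
      by (simp add: embed_def l_def)
  qed (simp_all add: embed_vspace_l zero_vspace)
  moreover have "(act N ^^ n) (\<lambda>i. 0\<^sub>v l) = (\<lambda>i. 0\<^sub>v l)" for n
    using zero_vcone[OF N_carrier] by (intro act_power_fixed) (simp add: vcone_iff)
  ultimately have "vseq_tendsto l (\<lambda>n. (act N ^^ n) (embed sz L k (\<lambda>i. 0\<^sub>v (sz k)))) (\<lambda>i. 0\<^sub>v l)"
    by (simp add: vseq_tendsto_iff zero_vspace)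
  with zero_vcone[OF A_carrier]
  show "(\<lambda>i. 0\<^sub>v (sz k)) \<in> dcone k" "lift k (\<lambda>i. 0\<^sub>v (sz k)) = (\<lambda>i. 0\<^sub>v l)"
    by (rule lift_eqI)+
qed


section \<open>Peeling off the last block\<close>

text \<open>
  The remainder of \<open>v\<close> after removing its \<open>k\<close>-th block lives in the first \<open>k - 1\<close>
  blocks, where \<open>N\<close> agrees with its truncation \<open>Nhat (k - 1)\<close>; and that truncation does not see
  block \<open>k\<close>. Hence \<open>N\<^sup>n\<close> maps the remainder to the truncated iterate of \<open>v\<close>, from
  the first step on, while it fixes \<open>v\<close>. Subtracting gives the iterates of the embedded block.
\<close>

lemma iterate_embed_component:
  assumes k: "k \<in> {1..L}" and v: "v \<in> vcone l (Nhat k)" and n: "0 < n"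
  shows "(act N ^^ n) (embed sz L k (blk k v)) = vcomb 1 v (-1) ((act (Nhat (k - 1)) ^^ n) v)"
proof -
  let ?e = "embed sz L k (blk k v)" and ?r = "vcomb 1 v (-1) (embed sz L k (blk k v))"
  have vN: "v \<in> vcone l N" "spt k v" and sp: "v \<in> vspace l"
    using v vcone_Nhat_iff[of k v] k by (auto simp: vcone_vspace)
  have r: "?r \<in> vspace l"
    by (simp add: vcomb_vspace sp embed_vspace_l)
  have o: "offset sz (Suc (k - 1)) = offset sz k"
    using k by simp
  have r_spt: "spt (k - 1) ?r"
    using vN(2) k
    by (auto simp: supported_def o l_def[symmetric] vcomb_index[OF sp embed_vspace_l])
      (auto simp: embed_def component_def offset_Suc l_def)
  have it_sp: "(act (Nhat (k - 1)) ^^ n) v \<in> vspace l" for n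
    using act_power_vspace[OF Nhat_carrier sp] .
  have r_iter: "(act N ^^ m) ?r = (act (Nhat (k - 1)) ^^ m) ?r \<and> spt (k - 1) ((act N ^^ m) ?r)" for m
  proof (induction m)
    case 0
    then show ?case
      using r_spt by simp
  next
    case (Suc m)
    have "(act N ^^ m) ?r \<in> vspace l"
      using act_power_vspace[OF N_carrier r] .
    then have "act (Nhat (k - 1)) ((act N ^^ m) ?r) = act N ((act N ^^ m) ?r)"
      "spt (k - 1) (act N ((act N ^^ m) ?r))"
      using Suc k by (auto intro!: act_Nhat_eq_act act_supported)
    then show ?case
      using Suc by simp
  qed
  have "act (Nhat (k - 1)) ?r = act (Nhat (k - 1)) v"
    by (rule act_Nhat_cong[OF r sp])
      (simp add: vcomb_index[OF sp embed_vspace_l], simp add: o[unfolded One_nat_def] embed_def l_def)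
  then have "(act (Nhat (k - 1)) ^^ n) ?r = (act (Nhat (k - 1)) ^^ n) v"
    using n by (cases n) (simp_all add: funpow_swap1)
  then have rn: "(act N ^^ n) ?r = (act (Nhat (k - 1)) ^^ n) v"
    using r_iter by simp
  have "?e = vcomb 1 v (-1) ?r"
    by (rule vseq_eqI[of _ l])
      (simp_all add: embed_vspace_l vcomb_vspace sp vcomb_index[of _ l])
  then have "(act N ^^ n) ?e = (act N ^^ n) (vcomb 1 v (-1) ?r)"
    by simp
  also have "\<dots> = vcomb 1 ((act N ^^ n) v) (-1) ((act N ^^ n) ?r)"
    by (rule act_power_vcomb[OF N_carrier sp r])
  also have "(act N ^^ n) v = v"
    using vN(1) by (simp add: vcone_iff act_power_fixed)
  finally show ?thesis
    by (simp only: rn)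
qed

lemma truncation_limit:
  assumes k: "k \<in> {1..L}" and v: "v \<in> vcone l (Nhat k)"
  obtains w where "vseq_tendsto l (\<lambda>n. (act (Nhat (k - 1)) ^^ n) v) w" "w \<in> vcone l (Nhat (k - 1))"
proof -
  have nonneg: "0 \<le> Nhat (k - 1) i $$ (a, b)" if "a < l" "b < l" for i a b
    using that by (simp add: Nhat_index N_nonneg)
  have le: "Nhat (k - 1) i $$ (a, b) \<le> Nhat k i $$ (a, b)" if "a < l" "b < l" for i a b
    using that offset_mono[of k "Suc k" sz] k by (auto simp: Nhat_index N_nonneg)
  obtain w where w: "vseq_tendsto l (\<lambda>n. (act (Nhat (k - 1)) ^^ n) v) w"
    using iterates_of_smaller_mseq_convergent[OF Nhat_carrier Nhat_carrier nonneg le v]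
    by (auto simp: vseq_convergent_def)
  moreover have "w \<in> vcone l (Nhat (k - 1))"
    using v by (intro limit_of_iterates_in_vcone[OF Nhat_carrier nonneg _ _ w])
      (simp_all add: vcone_iff)
  ultimately show ?thesis
    using that by blast
qed

lemma peel_last_block:
  assumes k: "k \<in> {1..L}" and v: "v \<in> vcone l (Nhat k)"
    and w: "vseq_tendsto l (\<lambda>n. (act (Nhat (k - 1)) ^^ n) v) w"
  shows "blk k v \<in> dcone k" "lift k (blk k v) = vcomb 1 v (-1) w"
proof -
  have sp: "v \<in> vspace l" and vN: "v \<in> vcone l N" "spt k v"
    using v vcone_Nhat_iff[of k v] k by (auto simp: vcone_vspace)
  have "vseq_tendsto l (\<lambda>n. v) v"
    by (simp add: vseq_tendsto_iff sp)
  then have lim: "vseq_tendsto l (\<lambda>n. vcomb 1 v (-1) ((act (Nhat (k - 1)) ^^ n) v)) (vcomb 1 v (-1) w)"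
    by (rule vseq_tendsto_vcomb[OF _ w]) (simp_all add: sp act_power_vspace[OF Nhat_carrier])
  have ev: "\<forall>\<^sub>F n in sequentially. vcomb 1 v (-1) ((act (Nhat (k - 1)) ^^ n) v) i $ a
      = (act N ^^ n) (embed sz L k (blk k v)) i $ a" for i a
    using eventually_gt_at_top[of 0]
    by eventually_elim (simp add: iterate_embed_component[OF k v])
  have "vseq_tendsto l (\<lambda>n. (act N ^^ n) (embed sz L k (blk k v))) (vcomb 1 v (-1) w)"
    using lim Lim_transform_eventually[OF _ ev] unfolding vseq_tendsto_iff by blast
  with component_vcone[OF vN k]
  show "blk k v \<in> dcone k" "lift k (blk k v) = vcomb 1 v (-1) w"
    by (rule lift_eqI)+
qed

lemma truncation_surjective:
  assumes k: "k \<in> {1..L}"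
  shows "pi_hat sz L N k ` vcone l (Nhat k) = vcone l (Nhat (k - 1))"
proof (intro equalityI subsetI)
  fix w assume "w \<in> pi_hat sz L N k ` vcone l (Nhat k)"
  then obtain v where v: "v \<in> vcone l (Nhat k)" and w: "w = pi_hat sz L N k v"
    by auto
  obtain u where "vseq_tendsto l (\<lambda>n. (act (Nhat (k - 1)) ^^ n) v) u" "u \<in> vcone l (Nhat (k - 1))"
    using truncation_limit[OF k v] .
  then show "w \<in> vcone l (Nhat (k - 1))"
    using vseq_tendsto_lim by (auto simp: w pi_hat_def l_def)
next
  fix w assume w: "w \<in> vcone l (Nhat (k - 1))"
  \<comment> \<open>\<open>w\<close> is its own preimage, since the cones of the truncations are nested.\<close>
  have "w \<in> vcone l (Nhat k)"
    using w k by (auto simp: vcone_Nhat_iff intro: supported_mono)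
  moreover have "vseq_tendsto l (\<lambda>n. (act (Nhat (k - 1)) ^^ n) w) w"
    using w by (simp add: vseq_tendsto_iff vcone_iff act_power_fixed)
  then have "pi_hat sz L N k w = w"
    using vseq_tendsto_lim by (simp add: pi_hat_def l_def)
  ultimately show "w \<in> pi_hat sz L N k ` vcone l (Nhat k)"
    by force
qed

section \<open>The cone as a product\<close>

lemma Nhat_L: "vcone l (Nhat L) = vcone l N"
  by (auto simp: vcone_Nhat_iff supported_def total_size_eq_offset)

lemma vcone_decomposition_truncated:
  assumes "k \<le> L" "v \<in> vcone l (Nhat k)"
  shows "\<exists>W. (\<forall>j\<in>{1..k}. W j \<in> dcone j) \<and> v = vseq_sum l k (\<lambda>j. lift j (W j))"
  using assms
proof (induction k arbitrary: v)
  case 0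
  have "v = (\<lambda>i. 0\<^sub>v l)"
    using 0 by (intro vseq_eqI[of _ l])
      (auto simp: vcone_Nhat_iff vcone_vspace zero_vspace supported_def offset_def l_def[symmetric])
  then show ?case
    by (simp add: vseq_sum_0)
next
  case (Suc k)
  have k: "Suc k \<in> {1..L}"
    using Suc.prems by simp
  obtain w where lim: "vseq_tendsto l (\<lambda>n. (act (Nhat (Suc k - 1)) ^^ n) v) w"
    and w: "w \<in> vcone l (Nhat (Suc k - 1))"
    using truncation_limit[OF k Suc.prems(2)] .
  obtain W where W: "\<forall>j\<in>{1..k}. W j \<in> dcone j" "w = vseq_sum l k (\<lambda>j. lift j (W j))"
    using Suc.IH[of w] w Suc.prems by auto
  note peel = peel_last_block[OF k Suc.prems(2) lim]
  let ?W = "W(Suc k := blk (Suc k) v)"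
  have dW: "?W j \<in> dcone j" if "j \<in> {1..Suc k}" for j
    using that W(1) peel(1) by auto
  have sp: "\<forall>j\<in>{1..Suc k}. lift j (?W j) \<in> vspace l"
    using dW Suc.prems(1) by (intro ballI lift_vspace) auto
  have "w = vseq_sum l k (\<lambda>j. lift j (?W j))"
    unfolding W(2) using W(1) Suc.prems(1) by (intro vseq_sum_cong ballI lift_vspace) auto
  then have "vseq_sum l (Suc k) (\<lambda>j. lift j (?W j)) = vcomb 1 w 1 (vcomb 1 v (-1) w)"
    using sp by (simp add: vseq_sum_Suc peel(2) del: fun_upd_apply) (simp add: peel(2))
  also have "\<dots> = v"
    using vcone_vspace[OF w] vcone_vspace[OF Suc.prems(2)]
    by (intro vseq_eqI[of _ l]) (simp_all add: vcomb_vspace vcomb_index[of _ l])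
  finally show ?case
    using dW by (intro exI[of _ ?W]) auto
qed

lemma vcone_decomposition:
  assumes "v \<in> vcone l N"
  obtains W where "\<And>j. j \<in> {1..L} \<Longrightarrow> W j \<in> dcone j" "v = vseq_sum l L (\<lambda>j. lift j (W j))"
  using vcone_decomposition_truncated[of L v] assms Nhat_L by blast

text \<open>
  The lifts from blocks before \<open>k\<close> vanish in block \<open>k\<close>, and the lift from block \<open>k\<close>
  shows its vector there. So the largest block in which two decompositions differ is visible in
  their sums.
\<close>

lemma decomposition_unique:
  assumes W: "\<And>j. j \<in> {1..L} \<Longrightarrow> W j \<in> dcone j" and W': "\<And>j. j \<in> {1..L} \<Longrightarrow> W' j \<in> dcone j"
    and eq: "vseq_sum l L (\<lambda>j. lift j (W j)) = vseq_sum l L (\<lambda>j. lift j (W' j))"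
    and k: "k \<in> {1..L}"
  shows "W k = W' k"
proof (rule ccontr)
  assume neq: "W k \<noteq> W' k"
  let ?D = "{k \<in> {1..L}. W k \<noteq> W' k}"
  \<comment> \<open>The last block of disagreement: later lifts agree, and earlier ones vanish in it.\<close>
  define m where "m = Max ?D"
  have "m \<in> ?D"
    unfolding m_def using k neq by (intro Max_in) auto
  then have m: "m \<in> {1..L}" "W m \<noteq> W' m"
    by auto
  have above: "W j = W' j" if "j \<in> {1..L}" "m < j" for j
    using Max_ge[of ?D j] that by (fastforce simp: m_def)
  have "lift m (W m) i $ (offset sz m + a) = lift m (W' m) i $ (offset sz m + a)"
    if a: "a < sz m" for i a
  proof -
    let ?a = "offset sz m + a"
    have al: "?a < l"
      using a m(1) offset_le_l[of m] by (simp add: offset_Suc)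
    have below: "lift j x i $ ?a = 0" if "j \<in> {1..L}" "j < m" "x \<in> dcone j" for j x
      using lift_supported_component(1)[of x j] that al offset_mono[of "Suc j" m sz]
      by (simp add: supported_def l_def)
    have "(\<Sum>j=1..L. lift j (W j) i $ ?a) = (\<Sum>j=1..L. lift j (W' j) i $ ?a)"
      using arg_cong[OF eq, of "\<lambda>z. z i $ ?a"] al W W' by (simp add: vseq_sum_index lift_vspace)
    moreover have "(\<Sum>j\<in>{1..L} - {m}. lift j (W j) i $ ?a) = (\<Sum>j\<in>{1..L} - {m}. lift j (W' j) i $ ?a)"
    proof (rule sum.cong[OF refl])
      fix j assume j: "j \<in> {1..L} - {m}"
      show "lift j (W j) i $ ?a = lift j (W' j) i $ ?a"
        using j below[of j] above[of j] W W' by (cases "j < m") auto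
    qed
    ultimately show ?thesis
      using m(1) by (simp add: sum.remove)
  qed
  then have "blk m (lift m (W m)) = blk m (lift m (W' m))"
    by (intro vseq_eqI[of _ "sz m"]) (simp_all add: component_vspace, simp add: component_def)
  then show False
    using m W W' lift_supported_component(2) by metis
qed

lemma I_map_vcone:
  assumes "\<And>j. j \<in> {1..L} \<Longrightarrow> W j \<in> dcone j"
  shows "vseq_sum l L (\<lambda>j. lift j (W j)) \<in> vcone l N"
  using assms by (intro vseq_sum_vcone[OF N_carrier] ballI lift_vcone)

lemma bij_betw_I_map: "bij_betw (I_map sz L N) (\<Pi>\<^sub>E k\<in>{1..L}. dcone k) (vcone l N)"
  unfolding I_map_def l_def[symmetric]
proof (rule bij_betwI')
  fix W W' assume W: "W \<in> (\<Pi>\<^sub>E k\<in>{1..L}. dcone k)" and W': "W' \<in> (\<Pi>\<^sub>E k\<in>{1..L}. dcone k)"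
  show "vseq_sum l L (\<lambda>k. lift k (W k)) = vseq_sum l L (\<lambda>k. lift k (W' k)) \<longleftrightarrow> W = W'"
  proof
    assume eq: "vseq_sum l L (\<lambda>k. lift k (W k)) = vseq_sum l L (\<lambda>k. lift k (W' k))"
    show "W = W'"
      using W W' by (intro PiE_ext[OF W W'] decomposition_unique[OF _ _ eq]) (auto simp: PiE_mem)
  qed simp
next
  fix W assume "W \<in> (\<Pi>\<^sub>E k\<in>{1..L}. dcone k)"
  then show "vseq_sum l L (\<lambda>k. lift k (W k)) \<in> vcone l N"
    by (intro I_map_vcone) (auto simp: PiE_mem)
next
  fix v assume "v \<in> vcone l N"
  then obtain W where W: "\<And>j. j \<in> {1..L} \<Longrightarrow> W j \<in> dcone j" "v = vseq_sum l L (\<lambda>j. lift j (W j))"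
    using vcone_decomposition by blast
  have "v = vseq_sum l L (\<lambda>k. lift k (restrict W {1..L} k))"
    unfolding W(2) using W(1) by (intro vseq_sum_cong) (simp_all add: lift_vspace)
  then show "\<exists>W\<in>\<Pi>\<^sub>E k\<in>{1..L}. dcone k. v = vseq_sum l L (\<lambda>k. lift k (W k))"
    using W(1) by (intro bexI[of _ "restrict W {1..L}"]) auto
qed

lemma vcone_eq_sum_of_lifts:
  "vcone l N = {vseq_sum l L u | u. \<forall>k\<in>{1..L}. u k \<in> lift k ` dcone k}"
proof (intro equalityI subsetI)
  fix v assume "v \<in> vcone l N"
  then obtain W where "\<And>j. j \<in> {1..L} \<Longrightarrow> W j \<in> dcone j" "v = vseq_sum l L (\<lambda>j. lift j (W j))"
    using vcone_decomposition by blast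
  then show "v \<in> {vseq_sum l L u | u. \<forall>k\<in>{1..L}. u k \<in> lift k ` dcone k}"
    by blast
next
  fix v assume "v \<in> {vseq_sum l L u | u. \<forall>k\<in>{1..L}. u k \<in> lift k ` dcone k}"
  then obtain u where u: "v = vseq_sum l L u" "\<And>k. k \<in> {1..L} \<Longrightarrow> u k \<in> lift k ` dcone k"
    by blast
  show "v \<in> vcone l N"
    unfolding u(1)
  proof (intro vseq_sum_vcone[OF N_carrier] ballI)
    fix k assume k: "k \<in> {1..L}"
    obtain x where "x \<in> dcone k" "u k = lift k x"
      using u(2)[OF k] by auto
    with k show "u k \<in> vcone l N"
      by (simp add: lift_vcone)
  qed
qed

section \<open>Extreme vectors\<close>

lemma extreme_dcone_iff:
  assumes "k \<in> {1..L}"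
  shows "w \<in> extreme_vectors (sz k) (dcone k) \<longleftrightarrow>
    w \<in> dcone k \<and> w \<noteq> (\<lambda>i. 0\<^sub>v (sz k)) \<and>
    (\<forall>x\<in>dcone k. \<forall>y\<in>dcone k. \<forall>s. 0 < s \<and> s < 1 \<and> vcomb (1 - s) x s y \<in> vray w
      \<longrightarrow> x \<in> vray w \<and> y \<in> vray w)"
  using assms dist_vspace dist_scale(1) by (intro extreme_vectors_iff) auto

lemma extreme_vcone_iff:
  "v \<in> extreme_vectors l (vcone l N) \<longleftrightarrow>
    v \<in> vcone l N \<and> v \<noteq> (\<lambda>i. 0\<^sub>v l) \<and>
    (\<forall>x\<in>vcone l N. \<forall>y\<in>vcone l N. \<forall>s. 0 < s \<and> s < 1 \<and> vcomb (1 - s) x s y \<in> vray v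
      \<longrightarrow> x \<in> vray v \<and> y \<in> vray v)"
proof (intro extreme_vectors_iff)
  show "(\<lambda>i. t \<cdot>\<^sub>v v i) \<in> vcone l N" if "v \<in> vcone l N" "0 \<le> t" for v t
    using vcone_vcomb[OF N_carrier that(1) that(1) that(2), of 0] that(1)
    by (simp add: scaled_eq_vcomb[OF vcone_vspace])
qed (auto simp: vcone_vspace)

lemma lift_zero_iff:
  "x \<in> dcone k \<Longrightarrow> k \<in> {1..L} \<Longrightarrow> lift k x = (\<lambda>i. 0\<^sub>v l) \<longleftrightarrow> x = (\<lambda>i. 0\<^sub>v (sz k))"
  using lift_inj[OF _ dist_zero(1)] dist_zero(2) by metis

lemma lift_mem_vray_iff:
  assumes "x \<in> dcone k" "w \<in> dcone k" "k \<in> {1..L}"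
  shows "lift k x \<in> vray (lift k w) \<longleftrightarrow> x \<in> vray w"
proof
  assume "lift k x \<in> vray (lift k w)"
  then obtain t where t: "0 \<le> t" "lift k x = (\<lambda>i. t \<cdot>\<^sub>v lift k w i)"
    by (auto simp: vray_def)
  then have "x = (\<lambda>i. t \<cdot>\<^sub>v w i)"
    using dist_scale[OF assms(2,3) t(1)] assms by (auto intro: lift_inj[where k = k])
  with t(1) show "x \<in> vray w"
    by (auto simp: vray_def)
next
  assume "x \<in> vray w"
  then show "lift k x \<in> vray (lift k w)"
    using dist_scale[OF assms(2,3)] by (auto simp: vray_def)
qed

lemma sum_lift_single:
  assumes "k \<in> {1..L}" "W k \<in> dcone k" "\<And>j. j \<in> {1..L} - {k} \<Longrightarrow> W j = (\<lambda>i. 0\<^sub>v (sz j))"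
  shows "vseq_sum l L (\<lambda>j. lift j (W j)) = lift k (W k)"
  using assms by (intro vseq_sum_single) (simp_all add: lift_vspace dist_zero)

text \<open>
  If a point of the ray of \<open>lift k w\<close> lies between \<open>x\<close> and \<open>y\<close>, then uniqueness of
  decompositions puts the corresponding summands of \<open>x\<close> and \<open>y\<close> on opposite sides of zero in
  every block \<open>j \<noteq> k\<close>, which forces them to vanish since they are nonnegative. What is left is
  a segment in the cone of block \<open>k\<close>.
\<close>

lemma lift_extreme:
  assumes k: "k \<in> {1..L}" and ext: "w \<in> extreme_vectors (sz k) (dcone k)"
  shows "lift k w \<in> extreme_vectors l (vcone l N)"
proof -
  have w: "w \<in> dcone k" and w0: "w \<noteq> (\<lambda>i. 0\<^sub>v (sz k))"
    and face: "\<And>x y s. x \<in> dcone k \<Longrightarrow> y \<in> dcone k \<Longrightarrow> 0 < s \<Longrightarrow> s < 1 \<Longrightarrow>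
      vcomb (1 - s) x s y \<in> vray w \<Longrightarrow> x \<in> vray w \<and> y \<in> vray w"
    using ext extreme_dcone_iff[OF k] by auto
  have "x \<in> vray (lift k w) \<and> y \<in> vray (lift k w)"
    if x: "x \<in> vcone l N" and y: "y \<in> vcone l N" and s: "0 < s" "s < 1"
      and seg: "vcomb (1 - s) x s y \<in> vray (lift k w)" for x y s
  proof -
    obtain X where X: "\<And>j. j \<in> {1..L} \<Longrightarrow> X j \<in> dcone j" "x = vseq_sum l L (\<lambda>j. lift j (X j))"
      using vcone_decomposition[OF x] by blast
    obtain Y where Y: "\<And>j. j \<in> {1..L} \<Longrightarrow> Y j \<in> dcone j" "y = vseq_sum l L (\<lambda>j. lift j (Y j))"
      using vcone_decomposition[OF y] by blast
    obtain t where t: "0 \<le> t" "vcomb (1 - s) x s y = (\<lambda>i. t \<cdot>\<^sub>v lift k w i)"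
      using seg by (auto simp: vray_def)
    \<comment> \<open>Two decompositions of the same point of the ray, to be compared block by block.\<close>
    define Z where "Z j = vcomb (1 - s) (X j) s (Y j)" for j
    have Z: "Z j \<in> dcone j" "lift j (Z j) = vcomb (1 - s) (lift j (X j)) s (lift j (Y j))"
      if "j \<in> {1..L}" for j
      using dist_vcomb[OF X(1)[OF that] Y(1)[OF that] that] s by (simp_all add: Z_def)
    define T where "T j = (if j = k then (\<lambda>i. t \<cdot>\<^sub>v w i) else (\<lambda>i. 0\<^sub>v (sz j)))" for j
    have T: "T j \<in> dcone j" for j
      using dist_scale(1)[OF w k t(1)] by (simp add: T_def dist_zero)
    have "vseq_sum l L (\<lambda>j. lift j (Z j))
        = vseq_sum l L (\<lambda>j. vcomb (1 - s) (lift j (X j)) s (lift j (Y j)))"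
      using Z by (intro vseq_sum_cong ballI lift_vspace) auto
    also have "\<dots> = vcomb (1 - s) x s y"
      unfolding X(2) Y(2) using X(1) Y(1) by (intro vseq_sum_vcomb) (simp_all add: lift_vspace)
    also have "\<dots> = lift k (T k)"
      using dist_scale(2)[OF w k t(1)] t(2) by (simp add: T_def)
    also have "\<dots> = vseq_sum l L (\<lambda>j. lift j (T j))"
      by (intro sum_lift_single[of k T, OF k T, symmetric]) (simp add: T_def)
    finally have ZT: "Z j = T j" if "j \<in> {1..L}" for j
      using decomposition_unique[of Z T j] Z(1) T that by blast
    have XY0: "X j = (\<lambda>i. 0\<^sub>v (sz j))" "Y j = (\<lambda>i. 0\<^sub>v (sz j))" if j: "j \<in> {1..L} - {k}" for j
    proof -
      have XY: "X j \<in> dcone j" "Y j \<in> dcone j" "vcomb (1 - s) (X j) s (Y j) = (\<lambda>i. 0\<^sub>v (sz j))"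
        using j X(1) Y(1) ZT[of j] by (auto simp: Z_def T_def)
      note zero = nonneg_vcomb_eq_zeroD[OF dist_vspace[OF XY(1)] dist_vspace[OF XY(2)]
          dist_nonneg[OF XY(1)] dist_nonneg[OF XY(2)] _ s(1) XY(3)]
      show "X j = (\<lambda>i. 0\<^sub>v (sz j))" "Y j = (\<lambda>i. 0\<^sub>v (sz j))"
        using zero s(2) by simp_all
    qed
    have xy: "x = lift k (X k)" "y = lift k (Y k)"
      unfolding X(2) Y(2) using XY0 X(1) Y(1) k by (auto intro!: sum_lift_single)
    have "vcomb (1 - s) (X k) s (Y k) \<in> vray w"
      using ZT[OF k] t(1) by (auto simp: Z_def T_def vray_def)
    then have "X k \<in> vray w \<and> Y k \<in> vray w"
      using face X(1) Y(1) k s by blast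
    then show ?thesis
      using X(1) Y(1) k w by (simp add: xy lift_mem_vray_iff)
  qed
  moreover have "lift k w \<noteq> (\<lambda>i. 0\<^sub>v l)"
    using w0 w k by (simp add: lift_zero_iff)
  ultimately show ?thesis
    using lift_vcone[OF w k] unfolding extreme_vcone_iff by blast
qed

text \<open>
  An extreme vector lies on the same ray as each nonzero summand of its decomposition; so it is
  itself a lift from one block.
\<close>

lemma extreme_vector_is_lift:
  assumes ext: "v \<in> extreme_vectors l (vcone l N)"
  shows "\<exists>k\<in>{1..L}. \<exists>w\<in>extreme_vectors (sz k) (dcone k). v = lift k w"
proof -
  have v: "v \<in> vcone l N" and v0: "v \<noteq> (\<lambda>i. 0\<^sub>v l)"
    and face: "\<And>x y s. x \<in> vcone l N \<Longrightarrow> y \<in> vcone l N \<Longrightarrow> 0 < s \<Longrightarrow> s < 1 \<Longrightarrow>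
      vcomb (1 - s) x s y \<in> vray v \<Longrightarrow> x \<in> vray v \<and> y \<in> vray v"
    using ext extreme_vcone_iff by auto
  obtain W where W: "\<And>j. j \<in> {1..L} \<Longrightarrow> W j \<in> dcone j" "v = vseq_sum l L (\<lambda>j. lift j (W j))"
    using vcone_decomposition[OF v] by blast
  have "\<exists>k\<in>{1..L}. W k \<noteq> (\<lambda>i. 0\<^sub>v (sz k))"
  proof (rule ccontr)
    assume "\<not> ?thesis"
    then have "v = (\<lambda>i. 0\<^sub>v l)"
      unfolding W(2)
      by (intro vseq_eqI[of _ l])
        (simp_all add: vseq_sum_vspace vseq_sum_index zero_vspace dist_zero)
    with v0 show False ..
  qed
  then obtain k where k: "k \<in> {1..L}" and Wk: "W k \<noteq> (\<lambda>i. 0\<^sub>v (sz k))"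
    by blast
  define P where "P j = (if j = k then W j else (\<lambda>i. 0\<^sub>v (sz j)))" for j
  define Q where "Q j = (if j = k then (\<lambda>i. 0\<^sub>v (sz j)) else W j)" for j
  let ?p = "vseq_sum l L (\<lambda>j. lift j (P j))" and ?q = "vseq_sum l L (\<lambda>j. lift j (Q j))"
  have P: "P j \<in> dcone j" and Q: "Q j \<in> dcone j" if "j \<in> {1..L}" for j
    using W(1)[OF that] unfolding P_def Q_def by (metis dist_zero(1))+
  have p: "?p = lift k (W k)"
    using sum_lift_single[of k P, OF k P[OF k]] by (simp add: P_def)
  have pq_cone: "?p \<in> vcone l N" "?q \<in> vcone l N"
    using I_map_vcone[of P] I_map_vcone[of Q] P Q by blast+
  have pq: "v = vcomb 1 ?p 1 ?q"
  proof (rule vseq_eqI[of _ l])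
    fix i a assume a: "a < l"
    have sp: "lift j (W j) \<in> vspace l" "lift j (P j) \<in> vspace l" "lift j (Q j) \<in> vspace l"
      if "j \<in> {1..L}" for j
      using that by (simp_all add: W(1) P Q lift_vspace)
    have "lift j (W j) i $ a = lift j (P j) i $ a + lift j (Q j) i $ a" for j
      using a by (simp add: P_def Q_def dist_zero)
    then show "v i $ a = vcomb 1 ?p 1 ?q i $ a"
      unfolding W(2) using a sp
      by (simp add: vcomb_index[of _ l] vseq_sum_vspace vseq_sum_index sum.distrib)
  qed (use pq_cone v in \<open>simp_all add: vcone_vspace vcomb_vspace\<close>)
  \<comment> \<open>\<open>v\<close> is the midpoint of \<open>2p\<close> and \<open>2q\<close>, so \<open>p\<close> lies on its ray.\<close>
  let ?x = "vcomb 2 ?p 0 ?p" and ?y = "vcomb 2 ?q 0 ?q"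
  have mid: "vcomb (1 - 1/2) ?x (1/2) ?y = v"
    unfolding pq using pq_cone
    by (intro vseq_eqI[of _ l]) (simp_all add: vcomb_vspace vcone_vspace vcomb_index[of _ l])
  have xy_cone: "?x \<in> vcone l N" "?y \<in> vcone l N"
    using pq_cone by (simp_all add: vcone_vcomb[OF N_carrier])
  have vv: "v \<in> vray v"
    by (auto simp: vray_def intro!: exI[of _ 1])
  have "?x \<in> vray v"
    using face[OF xy_cone, of "1/2"] mid vv by simp
  then obtain t where t: "0 \<le> t" "?x = (\<lambda>i. t \<cdot>\<^sub>v v i)"
    by (auto simp: vray_def)
  have tv: "2 * lift k (W k) i $ a = t * v i $ a" if "a < l" for i a
    using arg_cong[OF t(2), of "\<lambda>z. z i $ a"] that vcone_vspace[OF v] vcone_vspace[OF pq_cone(1)]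
    by (simp add: vcomb_index[of _ l] vspace_dim p)
  have "t \<noteq> 0"
  proof
    assume "t = 0"
    then have "lift k (W k) = (\<lambda>i. 0\<^sub>v l)"
      using tv W(1) k by (intro vseq_eqI[of _ l]) (simp_all add: lift_vspace zero_vspace)
    then show False
      using lift_zero_iff W(1) k Wk by blast
  qed
  define w where "w = (\<lambda>i. (2 / t) \<cdot>\<^sub>v W k i)"
  have w: "w \<in> dcone k" "lift k w = (\<lambda>i. (2 / t) \<cdot>\<^sub>v lift k (W k) i)"
    using dist_scale[OF W(1)[OF k] k, of "2 / t"] t(1) by (simp_all add: w_def)
  have vw: "v = lift k w"
  proof (rule vseq_eqI[of _ l])
    fix i a assume a: "a < l"
    then show "v i $ a = lift k w i $ a"
      using tv[OF a, of i] \<open>t \<noteq> 0\<close> W(1) k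
      by (simp add: w(2) vspace_dim[OF lift_vspace] field_simps)
  qed (rule vcone_vspace[OF v], rule lift_vspace[OF w(1) k])
  have "w \<in> extreme_vectors (sz k) (dcone k)"
    unfolding extreme_dcone_iff[OF k]
  proof (intro conjI ballI allI impI; (elim conjE)?)
    show "w \<in> dcone k"
      by (rule w)
    show "w \<noteq> (\<lambda>i. 0\<^sub>v (sz k))"
      using v0 vw lift_zero_iff[OF w(1) k] by simp
    fix x y s
    assume x: "x \<in> dcone k" and y: "y \<in> dcone k" and s: "0 < s" "s < (1::real)"
      and seg: "vcomb (1 - s) x s y \<in> vray w"
    have "vcomb (1 - s) (lift k x) s (lift k y) \<in> vray v"
      using seg lift_mem_vray_iff[OF dist_vcomb(1)[OF x y k] w(1) k, of "1 - s" s]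
        dist_vcomb(2)[OF x y k, of "1 - s" s] s vw by simp
    then have "lift k x \<in> vray v \<and> lift k y \<in> vray v"
      using face lift_vcone x y k s by blast
    then show "x \<in> vray w" "y \<in> vray w"
      using lift_mem_vray_iff x y w(1) k vw by auto
  qed
  then show ?thesis
    using k vw by blast
qed

text \<open>A nonzero lift determines its block: the last one in which it does not vanish.\<close>

lemma lift_eq_imp_block_le:
  assumes "x \<in> dcone j" "y \<in> dcone k" "j \<in> {1..L}" "k \<in> {1..L}" "lift j x = lift k y"
    and "y \<noteq> (\<lambda>i. 0\<^sub>v (sz k))"
  shows "k \<le> j"
proof (rule ccontr)
  assume "\<not> k \<le> j"
  then have "lift k y i $ (offset sz k + a) = 0" if "a < sz k" for i a
    using that lift_supported_component(1)[OF assms(1,3)] assms(4,5) offset_mono[of "Suc j" k sz]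
      offset_le_l[of k]
    by (simp add: supported_def offset_Suc l_def)
  then have "blk k (lift k y) = (\<lambda>i. 0\<^sub>v (sz k))"
    by (intro vseq_eqI[of _ "sz k"] component_vspace zero_vspace) (simp add: component_def)
  then show False
    using assms lift_supported_component(2) by simp
qed

lemma bij_betw_lift_extreme:
  "bij_betw (\<lambda>(k, w). lift k w) (SIGMA k:{1..L}. extreme_vectors (sz k) (dcone k))
    (extreme_vectors l (vcone l N))"
  unfolding bij_betw_def
proof
  show "inj_on (\<lambda>(k, w). lift k w) (SIGMA k:{1..L}. extreme_vectors (sz k) (dcone k))"
  proof (rule inj_onI, clarify)
    fix j x k y
    assume j: "j \<in> {1..L}" and x: "x \<in> extreme_vectors (sz j) (dcone j)"
      and k: "k \<in> {1..L}" and y: "y \<in> extreme_vectors (sz k) (dcone k)"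
      and eq: "lift j x = lift k y"
    have xd: "x \<in> dcone j" "x \<noteq> (\<lambda>i. 0\<^sub>v (sz j))" and yd: "y \<in> dcone k" "y \<noteq> (\<lambda>i. 0\<^sub>v (sz k))"
      using x y extreme_dcone_iff j k by auto
    have "j = k"
      using lift_eq_imp_block_le[OF xd(1) yd(1) j k eq yd(2)]
        lift_eq_imp_block_le[OF yd(1) xd(1) k j eq[symmetric] xd(2)] by simp
    with lift_inj xd yd j eq show "j = k \<and> x = y"
      by blast
  qed
  show "(\<lambda>(k, w). lift k w) ` (SIGMA k:{1..L}. extreme_vectors (sz k) (dcone k))
      = extreme_vectors l (vcone l N)"
  proof (intro equalityI subsetI)
    fix v assume "v \<in> extreme_vectors l (vcone l N)"
    then obtain k w where "k \<in> {1..L}" "w \<in> extreme_vectors (sz k) (dcone k)" "v = lift k w"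
      using extreme_vector_is_lift by blast
    then show "v \<in> (\<lambda>(k, w). lift k w) ` (SIGMA k:{1..L}. extreme_vectors (sz k) (dcone k))"
      by (intro image_eqI[of _ _ "(k, w)"]) auto
  qed (auto intro: lift_extreme)
qed

end

section \<open>Sequences in Frobenius form\<close>

theorem theorem4p19:
  fixes N :: mseq and sz :: "nat \<Rightarrow> nat" and L l :: nat
  assumes l: "l = total_size sz L"
    and nonneg: "\<And>i. 0\<^sub>m l l \<le> N i"
    and reduced: "column_reduced N"
    and form: "frobenius_form sz L N"
  shows
    "(\<forall>k\<in>{2..L}.
        (\<forall>v \<in> vcone l (N_hat sz L N k).
            vseq_convergent l (\<lambda>n. (act (N_hat sz L N (k - 1)) ^^ n) v)) \<and>
        pi_hat sz L N k ` vcone l (N_hat sz L N k) = vcone l (N_hat sz L N (k - 1)))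
     \<and>
     (vcone l N =
        {vseq_sum l L u | u. \<forall>k\<in>{1..L}. u k \<in> iota sz L N k ` dist_cone sz L N k} \<and>
      bij_betw (I_map sz L N) (\<Pi>\<^sub>E k\<in>{1..L}. dist_cone sz L N k) (vcone l N))
     \<and>
     bij_betw (\<lambda>(k, w). iota sz L N k w)
        (SIGMA k:{1..L}. extreme_vectors (sz k) (dist_cone sz L N k))
        (extreme_vectors l (vcone l N))"
proof -
  have carrier: "N i \<in> carrier_mat l l" for i
    using form by (simp add: frobenius_form_def l)
  have entry_nonneg: "0 \<le> N i $$ (a, b)" if "a < l" "b < l" for i a b
    using nonneg[of i] carrier[of i] that by (auto simp: less_eq_mat_def)
  interpret nonneg_block_triangular N sz L l
    using l carrier entry_nonneg form
    by unfold_locales (simp_all add: frobenius_form_def)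
  have "vseq_convergent l (\<lambda>n. (act (N_hat sz L N (k - 1)) ^^ n) v)"
    if "k \<in> {2..L}" "v \<in> vcone l (N_hat sz L N k)" for k v
    using truncation_limit[of k v] that by (auto simp: vseq_convergent_def)
  moreover have "pi_hat sz L N k ` vcone l (N_hat sz L N k) = vcone l (N_hat sz L N (k - 1))"
    if "k \<in> {2..L}" for k
    using truncation_surjective[of k] that by simp
  ultimately show ?thesis
    using vcone_eq_sum_of_lifts bij_betw_I_map bij_betw_lift_extreme by blast
qed

end
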